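(* Let $\mathbf{A},\mathbf{B}$ be Medvedev degrees such that the open interval $(\mathbf{A},\mathbf{B})=\{\mathbf{X}: \mathbf{A}<_M\mathbf{X}<_M\mathbf{B}\}$ is nonempty. Then there are two Medvedev degrees in $(\mathbf{A},\mathbf{B})$ that are incomparable under $\le_M$.
   Context: A mass problem is a subset of Baire space $\omega^\omega$. For mass problems $\mathcal{A},\mathcal{B}$, $\mathcal{A}\le_M\mathcal{B}$ (Medvedev reducibility) iff there is a partial Turing functional $\Psi$ such that for every $f\in\mathcal{B}$, $\Psi(f)$ is defined and $\Psi(f)\in\mathcal{A}$; $\equiv_M$ is the induced equivalence relation and its classes are the Medvedev degrees, partially ordered by $\le_M$. *)

theory Defs
  imports Main
begin

text \<open>
  Turing functionals are presented by Kleene's schemes for the partial recursive functions,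
  relativised to an oracle. A program contains no oracle; the oracle is a parameter of the
  evaluation, so that one program acts uniformly on all of Baire space.
\<close>

datatype oracle_prog =
    Zero
  | Succ
  | Proj nat
  | Oracle
  | Comp oracle_prog "oracle_prog list"
  | PrimRec oracle_prog oracle_prog
  | Mu oracle_prog

text \<open>
  The value \<^term>\<open>None\<close> stands for divergence. Programs carry no arity: superfluous arguments are
  ignored, missing ones lead to divergence. Composition and primitive recursion are strict.
  The search \<^term>\<open>Mu p\<close> converges to \<open>y\<close> only if \<open>p\<close> converges on all candidates up to \<open>y\<close>.
\<close>

primrec eval :: "oracle_prog \<Rightarrow> (nat \<Rightarrow> nat) \<Rightarrow> nat list \<Rightarrow> nat option" where
  "eval Zero f xs = Some 0"
| "eval Succ f xs = (case xs of [] \<Rightarrow> None | x # _ \<Rightarrow> Some (Suc x))"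
| "eval (Proj i) f xs = (if i < length xs then Some (xs ! i) else None)"
| "eval Oracle f xs = (case xs of [] \<Rightarrow> None | x # _ \<Rightarrow> Some (f x))"
| "eval (Comp p qs) f xs = Option.bind (those (map (\<lambda>q. eval q f xs) qs)) (eval p f)"
| "eval (PrimRec p q) f xs =
     (case xs of
        [] \<Rightarrow> None
      | n # ys \<Rightarrow>
          rec_nat (eval p f ys) (\<lambda>k r. Option.bind r (\<lambda>v. eval q f (k # v # ys))) n)"
| "eval (Mu p) f xs =
     (let found = (\<lambda>y. eval p f (y # xs) = Some 0 \<and> (\<forall>z<y. \<exists>v. eval p f (z # xs) = Some (Suc v)))
      in if \<exists>y. found y then Some (LEAST y. found y) else None)"

text \<open>
  A functional is defined at \<open>f\<close> iff the computed function of one argument is total, that is, is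
  again a point of Baire space.
\<close>

definition functional_of :: "oracle_prog \<Rightarrow> (nat \<Rightarrow> nat) \<Rightarrow> (nat \<Rightarrow> nat) option" where
  "functional_of p f =
     (if \<forall>n. eval p f [n] \<noteq> None then Some (\<lambda>n. the (eval p f [n])) else None)"

definition turing_functional :: "((nat \<Rightarrow> nat) \<Rightarrow> (nat \<Rightarrow> nat) option) \<Rightarrow> bool" where
  "turing_functional \<Psi> \<longleftrightarrow> (\<exists>p. \<Psi> = functional_of p)"

type_synonym mass_problem = "(nat \<Rightarrow> nat) set"

definition medvedev_le :: "mass_problem \<Rightarrow> mass_problem \<Rightarrow> bool" where
  "medvedev_le \<A> \<B> \<longleftrightarrow> (\<exists>\<Psi>. turing_functional \<Psi> \<and> (\<forall>f\<in>\<B>. \<exists>g\<in>\<A>. \<Psi> f = Some g))"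

definition medvedev_equiv :: "mass_problem \<Rightarrow> mass_problem \<Rightarrow> bool" where
  "medvedev_equiv \<A> \<B> \<longleftrightarrow> medvedev_le \<A> \<B> \<and> medvedev_le \<B> \<A>"

primrec subst_oracle :: "oracle_prog \<Rightarrow> oracle_prog \<Rightarrow> oracle_prog" where
  "subst_oracle r Zero = Zero"
| "subst_oracle r Succ = Succ"
| "subst_oracle r (Proj i) = Proj i"
| "subst_oracle r Oracle = Comp r [Proj 0]"
| "subst_oracle r (Comp p qs) = Comp (subst_oracle r p) (map (subst_oracle r) qs)"
| "subst_oracle r (PrimRec p q) = PrimRec (subst_oracle r p) (subst_oracle r q)"
| "subst_oracle r (Mu p) = Mu (subst_oracle r p)"

lemma eval_subst_oracle:
  assumes "\<And>n. eval r f [n] = Some (g n)"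
  shows "eval (subst_oracle r p) f xs = eval p g xs"
proof (induction p arbitrary: xs)
  case Oracle
  then show ?case by (cases xs) (simp_all add: assms)
next
  case (Comp p qs)
  have "map (\<lambda>q. eval q f xs) (map (subst_oracle r) qs) = map (\<lambda>q. eval q g xs) qs"
    using Comp.IH(2) by simp
  moreover have "eval (subst_oracle r p) f = eval p g"
    using Comp.IH(1) by (simp add: fun_eq_iff)
  ultimately show ?case by (simp del: map_map)
next
  case (PrimRec p q)
  then show ?case by (cases xs) simp_all
qed simp_all

lemma functional_of_eq_Some_iff:
  "functional_of p f = Some g \<longleftrightarrow> (\<forall>n. eval p f [n] = Some (g n))"
  proof
  assume "functional_of p f = Some g"
  then show "\<forall>n. eval p f [n] = Some (g n)"
    by (auto simp: functional_of_def split: if_splits)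
next
  assume "\<forall>n. eval p f [n] = Some (g n)"
  then show "functional_of p f = Some g"
    by (simp add: functional_of_def)
qed

lemma medvedev_le_refl: "medvedev_le \<A> \<A>"
proof -
  have "functional_of Oracle f = Some f" for f
    by (simp add: functional_of_eq_Some_iff)
  then show ?thesis
    unfolding medvedev_le_def turing_functional_def by blast
qed

lemma medvedev_le_trans:
  assumes "medvedev_le \<A> \<B>" and "medvedev_le \<B> \<C>"
  shows "medvedev_le \<A> \<C>"
proof -
  obtain p where p: "\<And>f. f \<in> \<B> \<Longrightarrow> \<exists>g\<in>\<A>. functional_of p f = Some g"
    using assms(1) unfolding medvedev_le_def turing_functional_def by blast
  obtain r where r: "\<And>f. f \<in> \<C> \<Longrightarrow> \<exists>g\<in>\<B>. functional_of r f = Some g"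
    using assms(2) unfolding medvedev_le_def turing_functional_def by blast
  have "\<exists>h\<in>\<A>. functional_of (subst_oracle r p) f = Some h" if f: "f \<in> \<C>" for f
  proof -
    obtain g where g: "g \<in> \<B>" "functional_of r f = Some g" using r f by blast
    obtain h where h: "h \<in> \<A>" "functional_of p g = Some h" using p g(1) by blast
    have "functional_of (subst_oracle r p) f = Some h"
      using g(2) h(2) eval_subst_oracle[of r f g] by (simp add: functional_of_eq_Some_iff)
    then show ?thesis using h(1) by blast
  qed
  then show ?thesis
    unfolding medvedev_le_def turing_functional_def by blast
qed

quotient_type medvedev_degree = mass_problem / medvedev_equiv
proof (rule equivpI)
  show "reflp medvedev_equiv"
    by (simp add: reflp_def medvedev_equiv_def medvedev_le_refl)
  show "symp medvedev_equiv"
    by (simp add: symp_def medvedev_equiv_def)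
  show "transp medvedev_equiv"
    by (auto simp: transp_def medvedev_equiv_def intro: medvedev_le_trans)
qed

instantiation medvedev_degree :: order
begin

lift_definition less_eq_medvedev_degree :: "medvedev_degree \<Rightarrow> medvedev_degree \<Rightarrow> bool"
  is medvedev_le
  by (auto simp: medvedev_equiv_def intro: medvedev_le_trans)

definition less_medvedev_degree :: "medvedev_degree \<Rightarrow> medvedev_degree \<Rightarrow> bool" where
  "less_medvedev_degree \<a> \<b> \<longleftrightarrow> \<a> \<le> \<b> \<and> \<not> \<b> \<le> \<a>"

instance
proof
  fix \<a> \<b> \<c> :: medvedev_degree
  show "\<a> < \<b> \<longleftrightarrow> \<a> \<le> \<b> \<and> \<not> \<b> \<le> \<a>"
    by (rule less_medvedev_degree_def)
  show "\<a> \<le> \<a>"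
    by transfer (rule medvedev_le_refl)
  show "\<a> \<le> \<b> \<Longrightarrow> \<b> \<le> \<c> \<Longrightarrow> \<a> \<le> \<c>"
    by transfer (rule medvedev_le_trans)
  show "\<a> \<le> \<b> \<Longrightarrow> \<b> \<le> \<a> \<Longrightarrow> \<a> = \<b>"
    by transfer (simp add: medvedev_equiv_def)
qed

end

end

theory Submission
  imports Defs "HOL-Library.Countable"
begin

text \<open>
  Replacing \<open>\<A>\<close> by \<open>\<nat> \<times> \<A>\<close> provides fresh copies of each point. If no meet of \<open>\<B>\<close> with finitely
  many points of \<open>\<A>\<close> lies below \<open>\<A>\<close>, then a diagonal construction yields two incomparable
  problems between \<open>\<A>\<close> and \<open>\<B>\<close>. Otherwise take the least number of points; if there are at least
  two, the meets of \<open>\<B>\<close> with two of them are incomparable. Hence in an interval without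
  incomparable elements \<open>\<A>\<close> is the meet of \<open>\<B>\<close> with a single point. Applied to \<open>\<A> < \<B>\<close> and to an
  intermediate \<open>\<X> < \<B>\<close>, this gives points \<open>c\<close> and \<open>g\<close>, where \<open>g\<close> is strictly above \<open>c\<close> and computes
  no point of \<open>\<B>\<close>. Now apply the dichotomy to the meet of \<open>\<B>\<close> with the set of all \<open>c \<oplus> k\<close>, where
  \<open>k\<close> is a finite variant of \<open>g\<close>: a single point \<open>c \<oplus> k\<close> would be computed uniformly from all
  of them, hence from \<open>c\<close> alone, by a search over finite sequences.
\<close>

section \<open>Evaluation and reducibility in terms of programs\<close>

lemma those_map_eq_Some_iff:
  "those (map F qs) = Some vs \<longleftrightarrow> list_all2 (\<lambda>q v. F q = Some v) qs vs"
proof (induction qs arbitrary: vs)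
  case Nil
  then show ?case by auto
next
  case (Cons q qs)
  then show ?case by (cases vs) (auto split: option.splits)
qed

lemma medvedev_le_iff:
  "medvedev_le \<A> \<B> \<longleftrightarrow> (\<exists>p. \<forall>f\<in>\<B>. \<exists>g\<in>\<A>. \<forall>n. eval p f [n] = Some (g n))"
proof -
  have "medvedev_le \<A> \<B> \<longleftrightarrow> (\<exists>p. \<forall>f\<in>\<B>. \<exists>g\<in>\<A>. functional_of p f = Some g)"
    unfolding medvedev_le_def turing_functional_def by blast
  then show ?thesis by (simp only: functional_of_eq_Some_iff)
qed

lemma medvedev_le_subset: "\<B> \<subseteq> \<A> \<Longrightarrow> medvedev_le \<A> \<B>"
  using medvedev_le_refl[of \<A>] unfolding medvedev_le_def by blast

lemma eval_Comp1: "eval q f xs = Some a \<Longrightarrow> eval (Comp p [q]) f xs = eval p f [a]"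
  by simp

lemma eval_Comp2:
  "eval q f xs = Some a \<Longrightarrow> eval r f xs = Some b \<Longrightarrow> eval (Comp p [q, r]) f xs = eval p f [a, b]"
  by simp

section \<open>Elementary programs\<close>

primrec const_prog :: "nat \<Rightarrow> oracle_prog" where
  "const_prog 0 = Zero"
| "const_prog (Suc n) = Comp Succ [const_prog n]"

lemma eval_const_prog [simp]: "eval (const_prog n) f xs = Some n"
  by (induction n) simp_all

definition add_prog :: oracle_prog where
  "add_prog = PrimRec (Proj 0) (Comp Succ [Proj 1])"

lemma eval_add_prog [simp]: "eval add_prog f [m, n] = Some (m + n)"
  unfolding add_prog_def by (induction m) simp_all

definition pred_prog :: oracle_prog where
  "pred_prog = PrimRec Zero (Proj 0)"

lemma eval_pred_prog [simp]: "eval pred_prog f [n] = Some (n - 1)"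
  unfolding pred_prog_def by (induction n) simp_all

text \<open>The arguments are swapped: the recursion is on the subtrahend.\<close>

definition sub_prog :: oracle_prog where
  "sub_prog = PrimRec (Proj 0) (Comp pred_prog [Proj 1])"

lemma eval_sub_prog [simp]: "eval sub_prog f [m, n] = Some (n - m)"
  unfolding sub_prog_def by (induction m) simp_all

definition is_zero_prog :: oracle_prog where
  "is_zero_prog = PrimRec (const_prog 1) Zero"

lemma eval_is_zero_prog [simp]: "eval is_zero_prog f [n] = Some (if n = 0 then 1 else 0)"
  unfolding is_zero_prog_def by (induction n) simp_all

text \<open>Unlike in \<open>branch_prog\<close>, the discarded argument is still evaluated, so this
  suits only arguments that converge anyway, as in step-bounded evaluation.\<close>

definition guard_prog :: oracle_prog where
  "guard_prog = PrimRec Zero (Proj 2)"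

lemma eval_guard_prog [simp]: "eval guard_prog f [m, n] = Some (if m = 0 then 0 else n)"
  unfolding guard_prog_def by (induction m) simp_all

primrec eq_prog :: "nat \<Rightarrow> oracle_prog" where
  "eq_prog 0 = is_zero_prog"
| "eq_prog (Suc n) = PrimRec Zero (Comp (eq_prog n) [Proj 0])"

lemma eval_eq_prog [simp]: "eval (eq_prog n) f [m] = Some (if m = n then 1 else 0)"
proof (induction n arbitrary: m)
  case (Suc n)
  have "rec_nat (Some 0) (\<lambda>k r. Option.bind r (\<lambda>v. Some (if k = n then 1 else 0))) m =
      Some (if m = Suc n then 1 else 0)"
    by (induction m) simp_all
  then show ?case using Suc by simp
qed simp

text \<open>
  Composition is strict, so the branch that is not taken is suppressed by a primitive recursion
  of length zero.
\<close>

definition branch_prog :: "oracle_prog \<Rightarrow> oracle_prog \<Rightarrow> oracle_prog \<Rightarrow> oracle_prog" where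
  "branch_prog t p q =
     Comp add_prog
       [Comp (PrimRec Zero (Comp p [Proj 2])) [t, Proj 0],
        Comp (PrimRec Zero (Comp q [Proj 2])) [Comp is_zero_prog [t], Proj 0]]"

lemma eval_branch_prog:
  assumes "eval t f [n] = Some (if b then 1 else 0)"
    and "(if b then eval p f [n] else eval q f [n]) = Some v"
  shows "eval (branch_prog t p q) f [n] = Some v"
  using assms by (cases b) (simp_all add: branch_prog_def)

section \<open>Meets\<close>

abbreviation cons_fn :: "nat \<Rightarrow> (nat \<Rightarrow> nat) \<Rightarrow> nat \<Rightarrow> nat" where
  "cons_fn \<equiv> case_nat"

lemma medvedev_le_cons_image: "medvedev_le (cons_fn n ` \<A>) \<A>"
  unfolding medvedev_le_iff
proof (intro exI ballI)
  fix f assume "f \<in> \<A>"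
  have "eval (PrimRec (const_prog n) (Comp Oracle [Proj 0])) f [m] = Some (cons_fn n f m)" for m
    by (induction m) simp_all
  with \<open>f \<in> \<A>\<close>
  show "\<exists>g\<in>cons_fn n ` \<A>. \<forall>m. eval (PrimRec (const_prog n) (Comp Oracle [Proj 0])) f [m] = Some (g m)"
    by blast
qed

lemma medvedev_le_shift:
  assumes "\<And>f. f \<in> \<B> \<Longrightarrow> f \<circ> Suc \<in> \<A>"
  shows "medvedev_le \<A> \<B>"
  unfolding medvedev_le_iff
proof (intro exI ballI)
  fix f assume "f \<in> \<B>"
  moreover have "eval (Comp Oracle [Succ]) f [m] = Some ((f \<circ> Suc) m)" for m
    by simp
  ultimately show "\<exists>g\<in>\<A>. \<forall>m. eval (Comp Oracle [Succ]) f [m] = Some (g m)"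
    using assms by blast
qed

text \<open>A single program can read the first entry of the oracle and then choose between the two
  given reductions.\<close>

lemma medvedev_le_branch:
  assumes "medvedev_le \<A> {f \<in> \<B>. f 0 = n}" and "medvedev_le \<A> {f \<in> \<B>. f 0 \<noteq> n}"
  shows "medvedev_le \<A> \<B>"
proof -
  obtain p where p: "\<And>f. f \<in> \<B> \<Longrightarrow> f 0 = n \<Longrightarrow> \<exists>g\<in>\<A>. \<forall>m. eval p f [m] = Some (g m)"
    using assms(1) unfolding medvedev_le_iff by blast
  obtain q where q: "\<And>f. f \<in> \<B> \<Longrightarrow> f 0 \<noteq> n \<Longrightarrow> \<exists>g\<in>\<A>. \<forall>m. eval q f [m] = Some (g m)"
    using assms(2) unfolding medvedev_le_iff by blast
  define t where "t = Comp (eq_prog n) [Comp Oracle [Zero]]"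
  have t: "eval t f [m] = Some (if f 0 = n then 1 else 0)" for f m
    by (simp add: t_def)
  have "\<exists>g\<in>\<A>. \<forall>m. eval (branch_prog t p q) f [m] = Some (g m)" if f: "f \<in> \<B>" for f
  proof -
    obtain g where "g \<in> \<A>" "\<And>m. (if f 0 = n then eval p f [m] else eval q f [m]) = Some (g m)"
      using p[OF f] q[OF f] by (cases "f 0 = n") auto
    then show ?thesis using eval_branch_prog[OF t] by blast
  qed
  then show ?thesis unfolding medvedev_le_iff by blast
qed

text \<open>The infimum in the Medvedev order. The tags let one program recognise the side from
  which its oracle comes.\<close>

definition meet :: "mass_problem \<Rightarrow> mass_problem \<Rightarrow> mass_problem" where
  "meet \<A> \<B> = cons_fn 0 ` \<A> \<union> cons_fn 1 ` \<B>"

lemma meet_le1: "medvedev_le (meet \<A> \<B>) \<A>"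
  by (rule medvedev_le_trans[OF _ medvedev_le_cons_image[of 0]])
    (auto simp: meet_def intro: medvedev_le_subset)

lemma meet_le2: "medvedev_le (meet \<A> \<B>) \<B>"
  by (rule medvedev_le_trans[OF _ medvedev_le_cons_image[of 1]])
    (auto simp: meet_def intro: medvedev_le_subset)

lemma le_meetI:
  assumes "medvedev_le \<C> \<A>" and "medvedev_le \<C> \<B>"
  shows "medvedev_le \<C> (meet \<A> \<B>)"
proof (rule medvedev_le_branch[where n = 0])
  show "medvedev_le \<C> {f \<in> meet \<A> \<B>. f 0 = 0}"
    by (rule medvedev_le_trans[OF assms(1)], rule medvedev_le_shift) (auto simp: meet_def comp_def)
  show "medvedev_le \<C> {f \<in> meet \<A> \<B>. f 0 \<noteq> 0}"
    by (rule medvedev_le_trans[OF assms(2)], rule medvedev_le_shift) (auto simp: meet_def comp_def)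
qed

text \<open>One oracle gives one output, whose tag settles the side. For larger problems the side
  may vary with the oracle.\<close>

lemma meet_le_singleton_cases:
  assumes "medvedev_le (meet \<A> \<B>) {f}"
  shows "medvedev_le \<A> {f} \<or> medvedev_le \<B> {f}"
proof -
  obtain p g where g: "g \<in> meet \<A> \<B>" "\<And>n. eval p f [n] = Some (g n)"
    using assms unfolding medvedev_le_iff by blast
  have le: "medvedev_le {g} {f}"
    unfolding medvedev_le_iff using g(2) by blast
  from g(1) show ?thesis
  proof (unfold meet_def, elim UnE imageE)
    fix a assume "g = cons_fn 0 a" "a \<in> \<A>"
    then have "medvedev_le \<A> {g}" by (intro medvedev_le_shift) (simp add: comp_def)
    then show ?thesis using le medvedev_le_trans by blast
  next
    fix a assume "g = cons_fn 1 a" "a \<in> \<B>"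
    then have "medvedev_le \<B> {g}" by (intro medvedev_le_shift) (simp add: comp_def)
    then show ?thesis using le medvedev_le_trans by blast
  qed
qed

section \<open>Finite meets with singletons\<close>

definition fin_meet :: "mass_problem \<Rightarrow> (nat \<Rightarrow> nat) list \<Rightarrow> mass_problem" where
  "fin_meet \<B> as = foldr (\<lambda>a. meet {a}) as \<B>"

lemma fin_meet_simps [simp]:
  "fin_meet \<B> [] = \<B>"
  "fin_meet \<B> (a # as) = meet {a} (fin_meet \<B> as)"
  by (simp_all add: fin_meet_def)

lemma fin_meet_le: "medvedev_le (fin_meet \<B> as) \<B>"
  by (induction as) (auto intro: medvedev_le_refl medvedev_le_trans meet_le2)

text \<open>\<open>tagged \<B> X\<close> is the meet of \<open>\<B>\<close> with a family of points that carry nonzero tags.\<close>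

definition tagged :: "mass_problem \<Rightarrow> mass_problem \<Rightarrow> mass_problem" where
  "tagged \<B> X = cons_fn 0 ` \<B> \<union> X"

lemma tagged_le: "medvedev_le (tagged \<B> X) \<B>"
  by (rule medvedev_le_trans[OF _ medvedev_le_cons_image[of 0]])
    (auto simp: tagged_def intro: medvedev_le_subset)

lemma le_tagged:
  assumes "medvedev_le \<A> \<B>" and "\<And>f. f \<in> X \<Longrightarrow> f 0 \<noteq> 0 \<and> f \<circ> Suc \<in> \<A>"
  shows "medvedev_le \<A> (tagged \<B> X)"
proof (rule medvedev_le_branch[where n = 0])
  show "medvedev_le \<A> {f \<in> tagged \<B> X. f 0 = 0}"
    by (rule medvedev_le_trans[OF assms(1)], rule medvedev_le_shift)
      (auto simp: tagged_def comp_def dest: assms(2))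
  show "medvedev_le \<A> {f \<in> tagged \<B> X. f 0 \<noteq> 0}"
    by (rule medvedev_le_shift) (auto simp: tagged_def dest: assms(2))
qed

text \<open>Finitely many tags can be built into one program, and distinct tags identify the points;
  each induction step adds one branch.\<close>

lemma fin_meet_le_tagged:
  assumes "finite X" and "inj_on (\<lambda>f. f 0) X" and "\<And>f. f \<in> X \<Longrightarrow> f 0 \<noteq> 0 \<and> f \<circ> Suc \<in> \<A>"
  shows "\<exists>as. set as \<subseteq> \<A> \<and> medvedev_le (fin_meet \<B> as) (tagged \<B> X)"
  using assms
proof (induction X rule: finite_induct)
  case empty
  have "medvedev_le \<B> (tagged \<B> {})"
    by (rule medvedev_le_shift) (auto simp: tagged_def comp_def)
  then have "set [] \<subseteq> \<A> \<and> medvedev_le (fin_meet \<B> []) (tagged \<B> {})" by simp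
  then show ?case by blast
next
  case (insert f X)
  then obtain as where as: "set as \<subseteq> \<A>" "medvedev_le (fin_meet \<B> as) (tagged \<B> X)"
    by auto
  have f: "f 0 \<noteq> 0" "f \<circ> Suc \<in> \<A>" using insert.prems(2)[of f] by blast+
  let ?m = "meet {f \<circ> Suc} (fin_meet \<B> as)"
  have tag: "g 0 \<noteq> f 0" if "g \<in> X" for g
    using insert.prems(1) insert.hyps(2) that by (auto simp: inj_on_def)
  have "medvedev_le ?m (tagged \<B> (insert f X))"
  proof (rule medvedev_le_branch[where n = "f 0"])
    have "{g \<in> tagged \<B> (insert f X). g 0 = f 0} \<subseteq> {f}"
      using f(1) tag by (auto simp: tagged_def)
    then have "medvedev_le {f \<circ> Suc} {g \<in> tagged \<B> (insert f X). g 0 = f 0}"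
      by (intro medvedev_le_shift) auto
    then show "medvedev_le ?m {g \<in> tagged \<B> (insert f X). g 0 = f 0}"
      by (rule medvedev_le_trans[OF meet_le1])
    have "{g \<in> tagged \<B> (insert f X). g 0 \<noteq> f 0} \<subseteq> tagged \<B> X"
      by (auto simp: tagged_def)
    then show "medvedev_le ?m {g \<in> tagged \<B> (insert f X). g 0 \<noteq> f 0}"
      by (intro medvedev_le_trans[OF meet_le2] medvedev_le_trans[OF as(2)] medvedev_le_subset)
  qed
  then have "set ((f \<circ> Suc) # as) \<subseteq> \<A> \<and>
      medvedev_le (fin_meet \<B> ((f \<circ> Suc) # as)) (tagged \<B> (insert f X))"
    using as(1) f(2) by simp
  then show ?case by blast
qed

section \<open>Diagonalisation against all programs, and the resulting dichotomy\<close>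

instance oracle_prog :: countable
  by countable_datatype

text \<open>Nonstrict bounds suffice: two incomparable problems within the bounds cannot be
  equivalent to either endpoint.\<close>

definition incomparable_between :: "mass_problem \<Rightarrow> mass_problem \<Rightarrow> bool" where
  "incomparable_between \<A> \<B> \<longleftrightarrow>
     (\<exists>\<X> \<Y>. medvedev_le \<A> \<X> \<and> medvedev_le \<X> \<B> \<and> medvedev_le \<A> \<Y> \<and> medvedev_le \<Y> \<B> \<and>
       \<not> medvedev_le \<X> \<Y> \<and> \<not> medvedev_le \<Y> \<X>)"

text \<open>
  A diagonal construction with fresh tags: the \<open>n\<close>-th point is a witness against the \<open>n div 2\<close>-th
  program, and the points with even and with odd index form the two incomparable problems. Since
  the later tags exceed the tag of the value at the witness, this value is never added later.
\<close>

lemma incomparable_between_if_no_fin_meet_le: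
  assumes "medvedev_le \<A> \<B>"
    and no: "\<And>as. set as \<subseteq> \<A> \<Longrightarrow> \<not> medvedev_le (fin_meet \<B> as) \<A>"
  shows "incomparable_between \<A> \<B>"
proof -
  \<comment> \<open>Halving the index lets every program occur at an even and at an odd stage, once
    for each direction of the incomparability. \<open>S f n\<close> collects the earlier points of
    the side opposite to stage \<open>n\<close>.\<close>
  define \<Phi> where "\<Phi> n = functional_of (from_nat (n div 2))" for n
  define S where "S f n = {f j |j. j < n \<and> odd (n + j)}" for f :: "nat \<Rightarrow> nat \<Rightarrow> nat" and n
  define P where "P f n r \<longleftrightarrow> r 0 \<noteq> 0 \<and> r \<circ> Suc \<in> \<A> \<and>
      (\<forall>j<n. f j 0 < r 0 \<and> (\<forall>g. \<Phi> j (f j) = Some g \<longrightarrow> g 0 < r 0)) \<and>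
      (\<forall>g. \<Phi> n r = Some g \<longrightarrow> g \<notin> tagged \<B> (S f n))" for f n r
  have "\<exists>f. \<forall>n. P f n (f n)"
  proof (rule dependent_wellorder_choice)
    fix r :: "nat \<Rightarrow> nat" and f g :: "nat \<Rightarrow> nat \<Rightarrow> nat" and n
    assume eq: "\<And>m. m < n \<Longrightarrow> f m = g m"
    then have "S f n = S g n" unfolding S_def by metis
    then show "P f n r = P g n r" unfolding P_def using eq by simp
  next
    fix n and f :: "nat \<Rightarrow> nat \<Rightarrow> nat"
    assume IH: "\<And>m. m < n \<Longrightarrow> P f m (f m)"
    \<comment> \<open>A tag above all earlier tags and above the first values of all earlier
      outputs; a diverging computation contributes 0.\<close>
    define N where "N = Suc (\<Sum>j<n. f j 0 + (case \<Phi> j (f j) of None \<Rightarrow> 0 | Some g \<Rightarrow> g 0))"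
    have N: "f j 0 + (case \<Phi> j (f j) of None \<Rightarrow> 0 | Some g \<Rightarrow> g 0) < N" if "j < n" for j
      unfolding N_def less_Suc_eq_le
      by (rule member_le_sum[where f = "\<lambda>j. f j 0 + (case \<Phi> j (f j) of None \<Rightarrow> 0 | Some g \<Rightarrow> g 0)"])
        (use that in auto)
    have "\<exists>as. set as \<subseteq> \<A> \<and> medvedev_le (fin_meet \<B> as) (tagged \<B> (S f n))"
    proof (rule fin_meet_le_tagged)
      show "finite (S f n)" unfolding S_def by auto
      have "i = j" if "i < n" "j < n" "f i 0 = f j 0" for i j
        using IH that unfolding P_def by (metis less_irrefl nat_neq_iff)
      then show "inj_on (\<lambda>f. f 0) (S f n)"
        unfolding S_def inj_on_def by blast
      show "h 0 \<noteq> 0 \<and> h \<circ> Suc \<in> \<A>" if "h \<in> S f n" for h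
        using that IH unfolding S_def P_def by auto
    qed
    then have not_le: "\<not> medvedev_le (tagged \<B> (S f n)) \<A>"
      using no medvedev_le_trans by blast
    \<comment> \<open>Otherwise program \<open>n\<close> would reduce
      \<open>tagged \<B> (S f n)\<close> to the copy of \<A> with tag \<open>N\<close>, hence to
      \<A>.\<close>
    have "\<exists>r\<in>cons_fn N ` \<A>. \<forall>g. \<Phi> n r = Some g \<longrightarrow> g \<notin> tagged \<B> (S f n)"
    proof (rule ccontr)
      assume "\<not> ?thesis"
      then have "medvedev_le (tagged \<B> (S f n)) (cons_fn N ` \<A>)"
        unfolding medvedev_le_def turing_functional_def \<Phi>_def by blast
      then show False using not_le medvedev_le_cons_image medvedev_le_trans by blast
    qed
    then obtain a where "a \<in> \<A>" "\<And>g. \<Phi> n (cons_fn N a) = Some g \<Longrightarrow> g \<notin> tagged \<B> (S f n)"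
      by blast
    moreover have "cons_fn N a \<circ> Suc = a" by (simp add: comp_def)
    ultimately have "P f n (cons_fn N a)"
      unfolding P_def using N by (auto simp: N_def dest: N)
    then show "\<exists>r. P f n r" by blast
  qed
  then obtain f where f: "\<And>n. P f n (f n)" by blast
  define X where "X b = {f j |j. odd j = b}" for b
  have tags: "h 0 \<noteq> 0 \<and> h \<circ> Suc \<in> \<A>" if "h \<in> X b" for h b
    using that f unfolding X_def P_def by auto
  have "\<not> medvedev_le (tagged \<B> (X b)) (tagged \<B> (X (\<not> b)))" for b
  proof
    assume "medvedev_le (tagged \<B> (X b)) (tagged \<B> (X (\<not> b)))"
    then obtain p where
      p: "\<And>h. h \<in> tagged \<B> (X (\<not> b)) \<Longrightarrow> \<exists>g\<in>tagged \<B> (X b). functional_of p h = Some g"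
      unfolding medvedev_le_def turing_functional_def by blast
    \<comment> \<open>The stage that treats \<open>p\<close> and whose witness lies on the side of
      the oracles.\<close>
    define n where "n = 2 * to_nat p + (if b then 0 else 1)"
    have par: "odd n = (\<not> b)" and \<Phi>: "\<Phi> n = functional_of p"
      by (simp_all add: n_def \<Phi>_def)
    have "f n \<in> tagged \<B> (X (\<not> b))" using par by (auto simp: tagged_def X_def)
    then obtain g where g: "g \<in> tagged \<B> (X b)" "\<Phi> n (f n) = Some g"
      using p \<Phi> by auto
    have "g \<notin> tagged \<B> (S f n)" using f g(2) unfolding P_def by blast
    with g(1) obtain j where j: "g = f j" "odd j = b" "f j \<notin> S f n"
      by (auto simp: tagged_def X_def)
    \<comment> \<open>The parities differ, so \<open>j = n\<close> is impossible, and
      \<open>j < n\<close> would put \<open>f j\<close> into \<open>S f n\<close>.\<close>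
    then have "n < j" using par unfolding S_def
      by (cases n j rule: linorder_cases) auto
    then have "g 0 < f j 0" using f[of j] g(2) unfolding P_def by blast
    then show False using j(1) by simp
  qed
  from this[of True] this[of False] show ?thesis
    unfolding incomparable_between_def
    using tagged_le[of \<B>] le_tagged[OF assms(1) tags] by (intro exI[of _ "tagged \<B> (X True)"] exI[of _ "tagged \<B> (X False)"]) simp
qed

lemma incomparable_between_or_singleton:
  assumes "medvedev_le \<A> \<B>" and "\<not> medvedev_le \<B> \<A>"
  shows "incomparable_between \<A> \<B> \<or> (\<exists>a\<in>\<A>. medvedev_le (meet {a} \<B>) \<A>)"
proof (cases "\<exists>as. set as \<subseteq> \<A> \<and> medvedev_le (fin_meet \<B> as) \<A>")
  case False
  then show ?thesis using incomparable_between_if_no_fin_meet_le[OF assms(1)] by blast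
next
  case True
  define Q where "Q as \<longleftrightarrow> set as \<subseteq> \<A> \<and> medvedev_le (fin_meet \<B> as) \<A>" for as
  obtain as where as: "Q as" and min: "\<And>bs. Q bs \<Longrightarrow> length as \<le> length bs"
    using True ex_has_least_nat[of Q _ length] unfolding Q_def[symmetric] by blast
  consider "as = []" | a where "as = [a]" | a b cs where "as = a # b # cs"
    by (metis neq_Nil_conv)
  then show ?thesis
  proof cases
    case 1
    then show ?thesis using as assms(2) by (simp add: Q_def)
  next
    case 2
    then show ?thesis using as by (auto simp: Q_def)
  next
    case 3
    have le: "medvedev_le (meet {a} (meet {b} (fin_meet \<B> cs))) \<A>"
      and sub: "{a, b} \<union> set cs \<subseteq> \<A>"
      using as by (auto simp: Q_def 3)
    let ?a = "meet {a} \<B>" and ?b = "meet {b} \<B>" and ?R = "fin_meet \<B> cs"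
    have "\<not> Q (a # cs)" "\<not> Q (b # cs)" using min 3 by fastforce+
    then have nle: "\<not> medvedev_le (meet {a} ?R) \<A>" "\<not> medvedev_le (meet {b} ?R) \<A>"
      using sub by (auto simp: Q_def)
    have mono: "medvedev_le (meet {x} ?R) (meet {x} \<B>)" for x
      by (meson fin_meet_le le_meetI medvedev_le_trans meet_le1 meet_le2)
    have "\<not> medvedev_le ?a ?b"
    proof
      assume "medvedev_le ?a ?b"
      then have "medvedev_le (meet {a} ?R) {b}"
        using mono meet_le1 medvedev_le_trans by blast
      then have "medvedev_le (meet {a} ?R) (meet {a} (meet {b} ?R))"
        by (intro le_meetI meet_le1 meet_le2)
      then show False using nle(1) le medvedev_le_trans by blast
    qed
    moreover have "\<not> medvedev_le ?b ?a"
    proof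
      assume "medvedev_le ?b ?a"
      then have "medvedev_le (meet {b} ?R) {a}"
        using mono meet_le1 medvedev_le_trans by blast
      then have "medvedev_le (meet {b} ?R) (meet {a} (meet {b} ?R))"
        by (intro le_meetI medvedev_le_refl)
      then show False using nle(2) le medvedev_le_trans by blast
    qed
    moreover have "medvedev_le \<A> (meet {x} \<B>)" if "x \<in> \<A>" for x
      using that assms(1) by (simp add: le_meetI medvedev_le_subset)
    ultimately have "incomparable_between \<A> \<B>"
      unfolding incomparable_between_def
      using sub meet_le2[of "{a}"] meet_le2[of "{b}"]
      by (intro exI[of _ ?a] exI[of _ ?b]) simp
    then show ?thesis ..
  qed
qed

section \<open>Step-bounded evaluation\<close>

text \<open>The bound only limits the range of searches; everything else is as in \<^const>\<open>eval\<close>.\<close>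

primrec stp :: "nat \<Rightarrow> oracle_prog \<Rightarrow> (nat \<Rightarrow> nat) \<Rightarrow> nat list \<Rightarrow> nat option" where
  "stp s Zero f xs = Some 0"
| "stp s Succ f xs = (case xs of [] \<Rightarrow> None | x # _ \<Rightarrow> Some (Suc x))"
| "stp s (Proj i) f xs = (if i < length xs then Some (xs ! i) else None)"
| "stp s Oracle f xs = (case xs of [] \<Rightarrow> None | x # _ \<Rightarrow> Some (f x))"
| "stp s (Comp p qs) f xs = Option.bind (those (map (\<lambda>q. stp s q f xs) qs)) (stp s p f)"
| "stp s (PrimRec p q) f xs =
     (case xs of
        [] \<Rightarrow> None
      | n # ys \<Rightarrow>
          rec_nat (stp s p f ys) (\<lambda>k r. Option.bind r (\<lambda>v. stp s q f (k # v # ys))) n)"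
| "stp s (Mu p) f xs =
     (let a = LEAST z. s \<le> z \<or> \<not> (\<exists>v. stp s p f (z # xs) = Some (Suc v))
      in if stp s p f (a # xs) = Some 0 then Some a else None)"

lemma eval_Mu_eq_Some_iff:
  "eval (Mu p) f xs = Some a \<longleftrightarrow>
     eval p f (a # xs) = Some 0 \<and> (\<forall>z<a. \<exists>v. eval p f (z # xs) = Some (Suc v))"
  (is "_ \<longleftrightarrow> ?F a")
proof
  assume "eval (Mu p) f xs = Some a"
  then have *: "(if \<exists>y. ?F y then Some (LEAST y. ?F y) else None) = Some a"
    unfolding eval.simps Let_def .
  then have ex: "\<exists>y. ?F y"
    by (cases "\<exists>y. ?F y") simp_all
  have a: "a = (LEAST y. ?F y)"
    using * unfolding if_P[OF ex] option.inject by (rule sym)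
  show "?F a" using LeastI_ex[of ?F, OF ex] unfolding a[symmetric] .
next
  assume a: "?F a"
  have "(LEAST y. ?F y) = a"
  proof (rule Least_equality[where P = ?F, OF a])
    fix y assume "?F y"
    show "a \<le> y"
    proof (rule ccontr)
      assume "\<not> a \<le> y"
      then obtain v where "eval p f (y # xs) = Some (Suc v)" using a by (auto simp: not_le)
      then show False using \<open>?F y\<close> by simp
    qed
  qed
  then show "eval (Mu p) f xs = Some a"
    unfolding eval.simps Let_def if_P[OF exI[of ?F, OF a]] by (rule arg_cong)
qed

lemma eval_if_stp: "stp s p f xs = Some v \<Longrightarrow> eval p f xs = Some v"
proof (induction p arbitrary: xs v)
  case (Comp p qs)
  then obtain vs where vs: "list_all2 (\<lambda>q v. stp s q f xs = Some v) qs vs" "stp s p f vs = Some v"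
    by (auto simp: those_map_eq_Some_iff bind_eq_Some_conv)
  then have "list_all2 (\<lambda>q v. eval q f xs = Some v) qs vs"
    using Comp.IH(2) by (auto elim!: list.rel_mono_strong)
  then show ?case
    using Comp.IH(1)[OF vs(2)] by (auto simp: those_map_eq_Some_iff bind_eq_Some_conv)
next
  case (PrimRec p q)
  then obtain n ys where xs: "xs = n # ys" by (auto split: list.splits)
  from PrimRec.prems have "rec_nat (stp s p f ys)
      (\<lambda>k r. Option.bind r (\<lambda>v. stp s q f (k # v # ys))) n = Some v"
    by (simp add: xs)
  then have "rec_nat (eval p f ys) (\<lambda>k r. Option.bind r (\<lambda>v. eval q f (k # v # ys))) n = Some v"
    by (induction n arbitrary: v) (auto simp: bind_eq_Some_conv PrimRec.IH)
  then show ?case by (simp add: xs)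
next
  case (Mu p)
  \<comment> \<open>The bounded search stops at the bound, at divergence or at a zero; the final
    test for the value 0 keeps only genuine zeros.\<close>
  define Q where "Q z \<longleftrightarrow> s \<le> z \<or> \<not> (\<exists>v. stp s p f (z # xs) = Some (Suc v))" for z
  have v: "v = (LEAST z. Q z)" "stp s p f (v # xs) = Some 0"
    using Mu.prems by (auto simp: Let_def Q_def split: if_splits)
  have "\<exists>v. stp s p f (z # xs) = Some (Suc v)" if "z < v" for z
    using not_less_Least[of z Q] that v(1) unfolding Q_def by blast
  then show ?case
    unfolding eval_Mu_eq_Some_iff using Mu.IH v(2) by blast
qed (auto split: list.splits if_splits)

text \<open>Truth for all large bounds and all oracles close to \<open>f\<close> in Baire space,
  with one \<open>u\<close> measuring both.\<close>

definition near :: "(nat \<Rightarrow> nat) \<Rightarrow> (nat \<Rightarrow> (nat \<Rightarrow> nat) \<Rightarrow> bool) \<Rightarrow> bool" where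
  "near f P \<longleftrightarrow> (\<exists>u. \<forall>s h. u \<le> s \<longrightarrow> (\<forall>i<u. h i = f i) \<longrightarrow> P s h)"

lemma near_mono: "near f P \<Longrightarrow> (\<And>s h. P s h \<Longrightarrow> Q s h) \<Longrightarrow> near f Q"
  unfolding near_def by blast

lemma near_True: "(\<And>s h. P s h) \<Longrightarrow> near f P"
  unfolding near_def by blast

lemma near_conj: "near f P \<Longrightarrow> near f Q \<Longrightarrow> near f (\<lambda>s h. P s h \<and> Q s h)"
  unfolding near_def
proof (elim exE)
  fix u v
  assume "\<forall>s h. u \<le> s \<longrightarrow> (\<forall>i<u. h i = f i) \<longrightarrow> P s h"
    and "\<forall>s h. v \<le> s \<longrightarrow> (\<forall>i<v. h i = f i) \<longrightarrow> Q s h"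
  then show "\<exists>w. \<forall>s h. w \<le> s \<longrightarrow> (\<forall>i<w. h i = f i) \<longrightarrow> P s h \<and> Q s h"
    by (intro exI[of _ "max u v"]) auto
qed

lemma near_ge: "near f (\<lambda>s h. n \<le> s)"
  unfolding near_def by blast

lemma near_oracle: "near f (\<lambda>s h. h n = f n)"
  unfolding near_def by (intro exI[of _ "Suc n"]) simp

lemma near_all_less:
  "(\<And>i. i < n \<Longrightarrow> near f (P i)) \<Longrightarrow> near f (\<lambda>s h. \<forall>i<n::nat. P i s h)"
proof (induction n)
  case 0
  then show ?case by (simp add: near_True)
next
  case (Suc n)
  then have "near f (\<lambda>s h. (\<forall>i<n. P i s h) \<and> P n s h)"
    by (intro near_conj) auto
  then show ?case by (rule near_mono) (auto simp: less_Suc_eq)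
qed

text \<open>A convergent computation makes finitely many oracle queries and finitely many search
  steps. Each imposes a condition that holds near \<open>f\<close>, and finitely many such
  conditions can be combined.\<close>

lemma near_stp: "eval p f xs = Some v \<Longrightarrow> near f (\<lambda>s h. stp s p h xs = Some v)"
proof (induction p arbitrary: xs v)
  case Oracle
  then obtain x ys where "xs = x # ys" "v = f x" by (auto split: list.splits)
  then show ?case using near_oracle[of f x] by simp
next
  case (Comp p qs)
  then obtain vs where vs: "list_all2 (\<lambda>q v. eval q f xs = Some v) qs vs" "eval p f vs = Some v"
    by (auto simp: those_map_eq_Some_iff bind_eq_Some_conv)
  have "near f (\<lambda>s h. \<forall>i<length qs. stp s (qs ! i) h xs = Some (vs ! i))"
    by (rule near_all_less) (use vs(1) Comp.IH(2) in \<open>auto simp: list_all2_conv_all_nth\<close>)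
  then have "near f (\<lambda>s h. (\<forall>i<length qs. stp s (qs ! i) h xs = Some (vs ! i)) \<and>
      stp s p h vs = Some v)"
    using Comp.IH(1)[OF vs(2)] by (rule near_conj)
  then show ?case
    by (rule near_mono) (use vs(1) in
      \<open>auto simp: those_map_eq_Some_iff bind_eq_Some_conv list_all2_conv_all_nth\<close>)
next
  case (PrimRec p q)
  then obtain n ys where xs: "xs = n # ys" by (auto split: list.splits)
  from PrimRec.prems have "rec_nat (eval p f ys)
      (\<lambda>k r. Option.bind r (\<lambda>v. eval q f (k # v # ys))) n = Some v"
    by (simp add: xs)
  then have "near f (\<lambda>s h. rec_nat (stp s p h ys)
      (\<lambda>k r. Option.bind r (\<lambda>v. stp s q h (k # v # ys))) n = Some v)"
  proof (induction n arbitrary: v)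
    case 0
    then show ?case using PrimRec.IH(1) by simp
  next
    case (Suc n)
    then obtain w where w: "rec_nat (eval p f ys)
        (\<lambda>k r. Option.bind r (\<lambda>v. eval q f (k # v # ys))) n = Some w"
      "eval q f (n # w # ys) = Some v"
      by (auto simp: bind_eq_Some_conv)
    from near_conj[OF Suc.IH[OF w(1)] PrimRec.IH(2)[OF w(2)]]
    show ?case by (rule near_mono) simp
  qed
  then show ?case by (simp add: xs)
next
  case (Mu p)
  then have v: "eval p f (v # xs) = Some 0"
    and less: "\<And>z. z < v \<Longrightarrow> \<exists>w. eval p f (z # xs) = Some (Suc w)"
    unfolding eval_Mu_eq_Some_iff by auto
  have "near f (\<lambda>s h. \<forall>z<v. \<exists>w. stp s p h (z # xs) = Some (Suc w))"
  proof (rule near_all_less)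
    fix z assume "z < v"
    then obtain w where "eval p f (z # xs) = Some (Suc w)" using less by blast
    from Mu.IH[OF this] show "near f (\<lambda>s h. \<exists>w. stp s p h (z # xs) = Some (Suc w))"
      by (rule near_mono) blast
  qed
  \<comment> \<open>The condition \<open>v \<le> s\<close> keeps the bound from stopping the search
    before \<open>v\<close>.\<close>
  from near_conj[OF near_conj[OF this Mu.IH[OF v]] near_ge[of f v]]
  show ?case
  proof (rule near_mono)
    fix s h
    assume *: "((\<forall>z<v. \<exists>w. stp s p h (z # xs) = Some (Suc w)) \<and> stp s p h (v # xs) = Some 0) \<and> v \<le> s"
    have "(LEAST z. s \<le> z \<or> \<not> (\<exists>v. stp s p h (z # xs) = Some (Suc v))) = v"
    proof (rule Least_equality)
      show "s \<le> v \<or> \<not> (\<exists>w. stp s p h (v # xs) = Some (Suc w))" using * by simp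
      fix y assume "s \<le> y \<or> \<not> (\<exists>w. stp s p h (y # xs) = Some (Suc w))"
      then show "v \<le> y" using * not_le order_trans by blast
    qed
    then show "stp s (Mu p) h xs = Some v" using * by simp
  qed
qed (auto intro: near_True split: list.splits if_splits)

text \<open>The use principle: take the step bound equal to \<open>u\<close> and then remove it by
  soundness of \<open>stp\<close>.\<close>

lemma eval_near:
  assumes "eval p f xs = Some v"
  shows "\<exists>u. \<forall>h. (\<forall>i<u. h i = f i) \<longrightarrow> eval p h xs = Some v"
proof -
  obtain u where u: "\<And>s h. u \<le> s \<Longrightarrow> \<forall>i<u. h i = f i \<Longrightarrow> stp s p h xs = Some v"
    using near_stp[OF assms] unfolding near_def by blast
  have "eval p h xs = Some v" if "\<forall>i<u. h i = f i" for h
    using eval_if_stp[OF u[OF order_refl that]] .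
  then show ?thesis by blast
qed

text \<open>
  \<open>stp_prog w p n\<close> evaluates \<open>p\<close> on \<open>n\<close> arguments, preceded by an argument \<open>s\<close> that serves both as
  the step bound and as an index of the simulated oracle, which is computed by \<open>w\<close>. The value
  \<open>0\<close> encodes failure, and \<open>Suc v\<close> the value \<open>v\<close>.
\<close>

abbreviation enc :: "nat option \<Rightarrow> nat" where
  "enc r \<equiv> (case r of None \<Rightarrow> 0 | Some v \<Rightarrow> Suc v)"

primrec stp_prog :: "oracle_prog \<Rightarrow> oracle_prog \<Rightarrow> nat \<Rightarrow> oracle_prog" where
  "stp_prog w Zero = (\<lambda>n. const_prog 1)"
| "stp_prog w Succ = (\<lambda>n. if n = 0 then Zero else Comp Succ [Comp Succ [Proj 1]])"
| "stp_prog w (Proj i) = (\<lambda>n. if i < n then Comp Succ [Proj (Suc i)] else Zero)"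
| "stp_prog w Oracle = (\<lambda>n. if n = 0 then Zero else Comp Succ [Comp w [Proj 0, Proj 1]])"
| "stp_prog w (Comp p qs) = (\<lambda>n.
     foldr (\<lambda>t acc. Comp guard_prog [t n, acc]) (map (stp_prog w) qs)
       (Comp (stp_prog w p (length qs))
         (Proj 0 # map (\<lambda>t. Comp pred_prog [t n]) (map (stp_prog w) qs))))"
| "stp_prog w (PrimRec p q) = (\<lambda>n.
     if n = 0 then Zero
     else Comp
       (PrimRec (stp_prog w p (n - 1))
         (Comp guard_prog
           [Proj 1,
            Comp (stp_prog w q (Suc n))
              (Proj 2 # Proj 0 # Comp pred_prog [Proj 1] # map Proj [3..<n + 2])]))
       (Proj 1 # Proj 0 # map Proj [2..<Suc n]))"
| "stp_prog w (Mu p) = (\<lambda>n.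
     Comp
       (Comp guard_prog
         [Comp (stp_prog w p (Suc n)) (Proj 1 # Proj 0 # map Proj [2..<n + 2]),
          Comp guard_prog
            [Comp is_zero_prog
              [Comp pred_prog
                [Comp (stp_prog w p (Suc n)) (Proj 1 # Proj 0 # map Proj [2..<n + 2])]],
             Comp Succ [Proj 0]]])
       (Mu (Comp guard_prog
             [Comp pred_prog
               [Comp (stp_prog w p (Suc n)) (Proj 1 # Proj 0 # map Proj [2..<n + 2])],
              Comp sub_prog [Proj 0, Proj 1]])
        # map Proj [0..<Suc n]))"

lemma map_Proj_suffix:
  assumes "length xs = n" and "length as = k"
  shows "map (\<lambda>q. eval q f (as @ xs)) (map Proj [k..<n + k]) = map Some xs"
proof (rule nth_equalityI)
  fix i assume "i < length (map (\<lambda>q. eval q f (as @ xs)) (map Proj [k..<n + k]))"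
  then show "map (\<lambda>q. eval q f (as @ xs)) (map Proj [k..<n + k]) ! i = map Some xs ! i"
    using assms by (simp add: nth_append)
qed (use assms in simp)

lemma those_map_Some_id: "those (map Some xs) = Some xs"
  by (induction xs) simp_all

lemma eval_stp_prog:
  assumes w: "\<And>s i. eval w f [s, i] = Some (h s i)"
  shows "length xs = n \<Longrightarrow> eval (stp_prog w p n) f (s # xs) = Some (enc (stp s p (h s) xs))"
proof (induction p arbitrary: n xs)
  case Zero
  then show ?case by simp
next
  case Succ
  then show ?case by (cases xs) auto
next
  case (Proj i)
  then show ?case by auto
next
  case Oracle
  then show ?case by (cases xs) (auto simp: w)
next
  case (Comp p qs)
  let ?v = "\<lambda>q. stp s q (h s) xs"
  \<comment> \<open>The outer program runs even if an argument fails, a failure being decoded as 0.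
    It always converges, and the guards then discard its result.\<close>
  let ?base = "Comp (stp_prog w p (length qs))
    (Proj 0 # map (\<lambda>t. Comp pred_prog [t n]) (map (stp_prog w) qs))"
  have args: "map (\<lambda>q. eval q f (s # xs)) (map (\<lambda>t. Comp pred_prog [t n]) (map (stp_prog w) qs)) =
      map Some (map (\<lambda>q. enc (?v q) - 1) qs)"
    using Comp by simp
  have base: "eval ?base f (s # xs) = Some (enc (stp s p (h s) (map (\<lambda>q. enc (?v q) - 1) qs)))"
    using Comp.IH(1)[of "map (\<lambda>q. enc (?v q) - 1) qs" "length qs"]
    by (simp add: args those_map_Some_id del: map_map list.map_comp)
  have fold: "eval (foldr (\<lambda>t acc. Comp guard_prog [t n, acc]) (map (stp_prog w) rs) r) f (s # xs) =
      Some (if \<exists>q\<in>set rs. ?v q = None then 0 else b)"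
    if "eval r f (s # xs) = Some b" "set rs \<subseteq> set qs" for rs r b
    using that(2) by (induction rs) (use that(1) Comp in \<open>auto split: option.splits\<close>)
  show ?case
  proof (cases "\<exists>q\<in>set qs. ?v q = None")
    case True
    then have "those (map ?v qs) = None"
      by (induction qs) (auto split: option.splits)
    then show ?thesis using fold[OF base, of qs] True by simp
  next
    case False
    then have "map ?v qs = map Some (map (\<lambda>q. enc (?v q) - 1) qs)"
      by (auto split: option.splits)
    then have "those (map ?v qs) = Some (map (\<lambda>q. enc (?v q) - 1) qs)"
      by (simp only: those_map_Some_id)
    then show ?thesis using fold[OF base, of qs] False by simp
  qed
next
  case (PrimRec p q)
  show ?case
  proof (cases xs)
    case Nil
    then show ?thesis using PrimRec.prems by simp
  next
    case (Cons m ys)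
    \<comment> \<open>The recursion variable must come first, so the bound \<open>s\<close> is moved
      behind it; inside the step it stands at position 2.\<close>
    let ?step = "Comp guard_prog
           [Proj 1,
            Comp (stp_prog w q (Suc n))
              (Proj 2 # Proj 0 # Comp pred_prog [Proj 1] # map Proj [3..<n + 2])]"
    let ?rec = "\<lambda>m. rec_nat (stp s p (h s) ys)
      (\<lambda>k r. Option.bind r (\<lambda>v. stp s q (h s) (k # v # ys))) m"
    have n: "length ys = n - 1" "n \<noteq> 0" "length ys + 3 = n + 2" "length ys + 2 = Suc n"
      using PrimRec.prems Cons by auto
    have step: "eval ?step f (k # enc r # s # ys) =
        Some (enc (Option.bind r (\<lambda>v. stp s q (h s) (k # v # ys))))" for k r
    proof -
      have "map (\<lambda>q. eval q f (k # enc r # s # ys)) (map Proj [3..<n + 2]) = map Some ys"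
        using map_Proj_suffix[of ys "length ys" "[k, enc r, s]" 3 f] n(3) by simp
      then show ?thesis
        using PrimRec.IH(2)[of "k # (enc r - 1) # ys" "Suc n"] n
        by (cases r) (simp_all add: those_map_Some_id del: map_map list.map_comp)
    qed
    have rec: "eval (PrimRec (stp_prog w p (n - 1)) ?step) f (m # s # ys) = Some (enc (?rec m))"
    proof (induction m)
      case 0
      show ?case using PrimRec.IH(1)[OF n(1)] by simp
    next
      case (Suc m)
      then show ?case using step[of m "?rec m"] by (simp del: eval.simps(5))
    qed
    have "map (\<lambda>q. eval q f (s # m # ys)) (map Proj [2..<Suc n]) = map Some ys"
      using map_Proj_suffix[of ys "length ys" "[s, m]" 2 f]
      unfolding n(4) by (simp del: upt_Suc)
    then show ?thesis
      using rec n(2) unfolding Cons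
      by (simp add: those_map_Some_id del: map_map list.map_comp upt_Suc)
  qed
next
  case (Mu p)
  let ?t = "Comp (stp_prog w p (Suc n)) (Proj 1 # Proj 0 # map Proj [2..<n + 2])"
  have t: "eval ?t f (z # s # xs) = Some (enc (stp s p (h s) (z # xs)))" for z
  proof -
    have "map (\<lambda>q. eval q f (z # s # xs)) (map Proj [2..<n + 2]) = map Some xs"
      using map_Proj_suffix[of xs n "[z, s]" 2 f] Mu.prems by simp
    then show ?thesis
      using Mu.IH[of "z # xs" "Suc n"] Mu.prems
      by (simp add: those_map_Some_id del: map_map list.map_comp)
  qed
  let ?out = "Comp guard_prog
    [?t, Comp guard_prog
      [Comp is_zero_prog [Comp pred_prog [?t]], Comp Succ [Proj 0]]]"
  define a where "a = (LEAST z. s \<le> z \<or> \<not> (\<exists>v. stp s p (h s) (z # xs) = Some (Suc v)))"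
  \<comment> \<open>The test vanishes at a failure, at a value 0 and from \<open>s\<close> onwards,
    so this unbounded search always halts, exactly at \<open>a\<close>.\<close>
  let ?test = "Comp guard_prog [Comp pred_prog [?t], Comp sub_prog [Proj 0, Proj 1]]"
  have test: "eval ?test f (z # s # xs) =
      Some (if enc (stp s p (h s) (z # xs)) \<le> 1 then 0 else s - z)" for z
  proof -
    have "eval (Comp pred_prog [?t]) f (z # s # xs) = Some (enc (stp s p (h s) (z # xs)) - 1)"
      by (simp only: eval_Comp1[OF t] eval_pred_prog)
    moreover have "eval (Comp sub_prog [Proj 0, Proj 1]) f (z # s # xs) = Some (s - z)"
      by simp
    ultimately show ?thesis by (simp only: eval_Comp2 eval_guard_prog diff_is_0_eq)
  qed
  have a: "s \<le> a \<or> \<not> (\<exists>v. stp s p (h s) (a # xs) = Some (Suc v))"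
    unfolding a_def by (rule LeastI[of _ s]) simp
  have "eval (Mu ?test) f (s # xs) = Some a"
    unfolding eval_Mu_eq_Some_iff test
  proof (intro conjI allI impI)
    have "enc r \<le> 1 \<or> (\<exists>v. r = Some (Suc v))" for r
      by (auto split: option.splits) (metis not0_implies_Suc)
    then have "enc (stp s p (h s) (a # xs)) \<le> 1 \<or> s - a = 0"
      using a by fastforce
    then show "Some (if enc (stp s p (h s) (a # xs)) \<le> 1 then 0 else s - a) = Some 0"
      by auto
    fix z assume "z < a"
    then have "\<not> s \<le> z" "\<exists>v. stp s p (h s) (z # xs) = Some (Suc v)"
      using not_less_Least[OF \<open>z < a\<close>[unfolded a_def]] by simp_all
    then show "\<exists>v. Some (if enc (stp s p (h s) (z # xs)) \<le> 1 then 0 else s - z) = Some (Suc v)"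
      by (auto simp: not0_implies_Suc)
  qed
  moreover have "map (\<lambda>q. eval q f (s # xs)) (map Proj [0..<Suc n]) = map Some (s # xs)"
    using map_Proj_suffix[of "s # xs" "Suc n" "[]" 0 f] Mu.prems by simp
  ultimately have "those (map (\<lambda>q. eval q f (s # xs)) (Mu ?test # map Proj [0..<Suc n])) =
      Some (a # s # xs)"
    by (simp add: those_map_Some_id del: map_map list.map_comp eval.simps upt_Suc)
  moreover have "stp s (Mu p) (h s) xs = (if stp s p (h s) (a # xs) = Some 0 then Some a else None)"
    by (simp add: a_def)
  \<comment> \<open>Only the code 1, which stands for the value 0, counts as success; code 0 is
    divergence and a larger code means that the bound was reached.\<close>
  moreover have "eval ?out f (a # s # xs) =
      Some (enc (if stp s p (h s) (a # xs) = Some 0 then Some a else None))"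
  proof -
    let ?e = "enc (stp s p (h s) (a # xs))"
    have "eval (Comp is_zero_prog [Comp pred_prog [?t]]) f (a # s # xs) =
        Some (if ?e - 1 = 0 then 1 else 0)"
      by (simp only: eval_Comp1[OF t] eval_Comp1[of "Comp pred_prog [?t]"] eval_pred_prog
        eval_is_zero_prog)
    moreover have "eval (Comp Succ [Proj 0]) f (a # s # xs) = Some (Suc a)"
      by simp
    ultimately have "eval ?out f (a # s # xs) =
        Some (if ?e = 0 then 0 else if (if ?e - 1 = 0 then 1 else 0) = (0::nat) then 0 else Suc a)"
      by (simp only: eval_Comp2[OF t] eval_Comp2 eval_guard_prog)
    then show ?thesis by (auto split: option.splits)
  qed
  ultimately show ?case
    unfolding stp_prog.simps eval.simps(5)[of ?out] by (simp only: bind.bind_lunit)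
qed

section \<open>Pairing and finite sequences\<close>

text \<open>\<open>pair a b = 2 ^ a * (2 * b + 1) - 1\<close>, so that \<open>a\<close> is the number of trailing binary ones.\<close>

primrec pair :: "nat \<Rightarrow> nat \<Rightarrow> nat" where
  "pair 0 b = 2 * b"
| "pair (Suc a) b = Suc (2 * pair a b)"

abbreviation half :: "nat \<Rightarrow> nat" where
  "half n \<equiv> n div 2"

definition head :: "nat \<Rightarrow> nat" where
  "head n = (LEAST a. even ((half ^^ a) n))"

definition tail :: "nat \<Rightarrow> nat" where
  "tail n = (half ^^ Suc (head n)) n"

lemma pair_surj: "\<exists>a b. n = pair a b"
proof (induction n rule: less_induct)
  case (less n)
  show ?case
  proof (cases "even n")
    case True
    then have "n = pair 0 (half n)" by simp
    then show ?thesis by blast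
  next
    case False
    then obtain m where m: "n = Suc (2 * m)" by (auto elim: oddE)
    then obtain a b where "m = pair a b" using less[of m] by auto
    then have "n = pair (Suc a) b" using m by simp
    then show ?thesis by blast
  qed
qed

lemma half_funpow_pair: "j \<le> a \<Longrightarrow> (half ^^ j) (pair a b) = pair (a - j) b"
proof (induction j)
  case (Suc j)
  then have "a - j = Suc (a - Suc j)" by simp
  then show ?case using Suc by simp
qed simp

lemma odd_pair: "a \<noteq> 0 \<Longrightarrow> odd (pair a b)"
  by (cases a) simp_all

lemma head_pair [simp]: "head (pair a b) = a"
  unfolding head_def
proof (rule Least_equality)
  show "even ((half ^^ a) (pair a b))" by (simp add: half_funpow_pair)
  fix j assume "even ((half ^^ j) (pair a b))"
  then show "a \<le> j" using half_funpow_pair[of j a b] odd_pair[of "a - j" b]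
    by (cases "j < a") simp_all
qed

lemma tail_pair [simp]: "tail (pair a b) = b"
  by (simp add: tail_def half_funpow_pair)

definition parity_prog :: oracle_prog where
  "parity_prog = PrimRec Zero (Comp is_zero_prog [Proj 1])"

lemma eval_parity_prog [simp]: "eval parity_prog f [n] = Some (n mod 2)"
  unfolding parity_prog_def by (induction n) (auto simp: mod_Suc)

definition half_prog :: oracle_prog where
  "half_prog = PrimRec Zero (Comp add_prog [Proj 1, Comp parity_prog [Proj 0]])"

lemma eval_half_prog [simp]: "eval half_prog f [n] = Some (half n)"
proof (induction n)
  case (Suc n)
  have "half n + n mod 2 = half (Suc n)" by presburger
  then show ?case using Suc by (simp add: half_prog_def)
qed (simp add: half_prog_def)

definition half_iter_prog :: oracle_prog where
  "half_iter_prog = PrimRec (Proj 0) (Comp half_prog [Proj 1])"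

lemma eval_half_iter_prog [simp]: "eval half_iter_prog f [a, n] = Some ((half ^^ a) n)"
  unfolding half_iter_prog_def by (induction a) simp_all

definition head_prog :: oracle_prog where
  "head_prog = Mu (Comp parity_prog [half_iter_prog])"

lemma eval_head_prog [simp]: "eval head_prog f [n] = Some (head n)"
proof -
  obtain a b where n: "n = pair a b" using pair_surj by blast
  have "(half ^^ j) n mod 2 = Suc 0" if "j < a" for j
    using that odd_pair[of "a - j" b] by (simp add: n half_funpow_pair odd_iff_mod_2_eq_one)
  then show ?thesis
    unfolding head_prog_def eval_Mu_eq_Some_iff by (simp add: n half_funpow_pair)
qed

definition tail_prog :: oracle_prog where
  "tail_prog = Comp half_iter_prog [Comp Succ [head_prog], Proj 0]"

lemma eval_tail_prog [simp]: "eval tail_prog f [n] = Some (tail n)"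
  by (simp add: tail_prog_def tail_def)

definition tail_iter_prog :: oracle_prog where
  "tail_iter_prog = PrimRec (Proj 0) (Comp tail_prog [Proj 1])"

lemma eval_tail_iter_prog [simp]: "eval tail_iter_prog f [i, n] = Some ((tail ^^ i) n)"
  unfolding tail_iter_prog_def by (induction i) simp_all

definition pair_prog :: oracle_prog where
  "pair_prog = PrimRec (Comp add_prog [Proj 0, Proj 0]) (Comp Succ [Comp add_prog [Proj 1, Proj 1]])"

lemma eval_pair_prog [simp]: "eval pair_prog f [a, b] = Some (pair a b)"
  unfolding pair_prog_def by (induction a) simp_all

text \<open>Every number codes an infinite sequence, so the simulated oracle is total and no length
  needs to be stored.\<close>

definition entry :: "nat \<Rightarrow> nat \<Rightarrow> nat" where
  "entry n i = head ((tail ^^ i) n)"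

text \<open>Codes of a prescribed prefix arise by pairing on further entries. The bound
  \<open>u < n\<close> lets the code double as a sufficiently large step bound.\<close>

lemma entry_dense: "\<exists>n>u. \<forall>i<u. entry n i = k i"
proof (induction u arbitrary: k)
  case 0
  show ?case by blast
next
  case (Suc u)
  then obtain n where n: "u < n" "\<And>i. i < u \<Longrightarrow> entry n i = k (Suc i)" by meson
  have "2 * n \<le> pair a n" for a by (induction a) simp_all
  from this[of "k 0"] have "Suc u < pair (k 0) n" using n(1) by linarith
  moreover have "entry (pair (k 0) n) i = k i" if "i < Suc u" for i
    using that n(2) by (cases i) (simp_all add: entry_def funpow_Suc_right del: funpow.simps(2))
  ultimately show ?case by blast
qed

section \<open>Singletons\<close>

lemma medvedev_le_singletonI: "(\<And>n. eval p g [n] = Some (f n)) \<Longrightarrow> medvedev_le {f} {g}"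
  unfolding medvedev_le_iff by blast

lemma medvedev_le_singletonD: "medvedev_le {f} {g} \<Longrightarrow> \<exists>p. \<forall>n. eval p g [n] = Some (f n)"
  unfolding medvedev_le_iff by blast

text \<open>The supremum of two points. Pairing coordinatewise makes a prefix of the join depend
  only on prefixes of the same length.\<close>

definition join :: "(nat \<Rightarrow> nat) \<Rightarrow> (nat \<Rightarrow> nat) \<Rightarrow> nat \<Rightarrow> nat" where
  "join f g i = pair (f i) (g i)"

lemma le_join2: "medvedev_le {g} {join f g}"
  by (rule medvedev_le_singletonI[of "Comp tail_prog [Oracle]"]) (simp add: join_def)

lemma join_le:
  assumes "medvedev_le {f} {h}" and "medvedev_le {g} {h}"
  shows "medvedev_le {join f g} {h}"
proof -
  obtain p q where "\<And>n. eval p h [n] = Some (f n)" "\<And>n. eval q h [n] = Some (g n)"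
    using assms medvedev_le_singletonD by metis
  then show ?thesis
    by (intro medvedev_le_singletonI[of "Comp pair_prog [p, q]"]) (simp add: join_def)
qed

lemma fun_upd_le: "medvedev_le {k(i := v)} {k}"
  by (rule medvedev_le_singletonI[of "Comp (PrimRec Oracle (const_prog v)) [eq_prog i, Proj 0]"])
    simp

text \<open>The finitely many corrections are built into the program, which therefore depends on
  \<open>k'\<close> and \<open>k\<close>.\<close>

lemma finite_change_le:
  assumes "finite D" and "\<And>i. i \<notin> D \<Longrightarrow> k' i = k i"
  shows "medvedev_le {k'} {k}"
  using assms
proof (induction D arbitrary: k' rule: finite_induct)
  case empty
  then have "k' = k" by auto
  then show ?case by (simp add: medvedev_le_refl)
next
  case (insert i D)
  have "medvedev_le {k'(i := k i)} {k}"
    by (rule insert.IH) (use insert.prems in auto)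
  moreover have "medvedev_le {k'} {k'(i := k i)}"
    using fun_upd_le[of "k'(i := k i)" i "k' i"] by simp
  ultimately show ?case using medvedev_le_trans by blast
qed

text \<open>
  A value computed from \<open>join c k\<close> for all finite variants \<open>k\<close> of \<open>g\<close> is found from \<open>c\<close> alone, by
  searching for a finite sequence on which the computation halts: every finite sequence is
  extended by some finite variant of \<open>g\<close>, which makes the value correct.
\<close>

lemma le_if_uniform:
  assumes e: "\<And>k n. finite {i. k i \<noteq> g i} \<Longrightarrow> eval p (join c k) [n] = Some (e n)"
  shows "medvedev_le {e} {c}"
proof -
  \<comment> \<open>The first component is read from the true oracle \<open>c\<close>, the second is
    decoded from \<open>s\<close>.\<close>
  define w where
    "w = Comp pair_prog [Comp Oracle [Proj 1],
      Comp head_prog [Comp tail_iter_prog [Proj 1, Proj 0]]]"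
  have w: "eval w c [s, i] = Some (join c (entry s) i)" for s i
    by (simp add: w_def join_def entry_def)
  define t where "t = stp_prog w p 1"
  have t: "eval t c [s, n] = Some (enc (stp s p (join c (entry s)) [n]))" for s n
    unfolding t_def by (rule eval_stp_prog[OF w]) simp
  have correct: "v = e n" if halt: "stp s p (join c (entry s)) [n] = Some v" for s n v
  proof -
    obtain u where u: "\<And>h. \<forall>i<u. h i = join c (entry s) i \<Longrightarrow> eval p h [n] = Some v"
      using eval_near[OF eval_if_stp[OF halt]] by blast
    \<comment> \<open>The part of \<open>entry s\<close> that the computation used, continued by
      \<open>g\<close>: a finite variant of \<open>g\<close>, for which the value is
      prescribed.\<close>
    define k where "k i = (if i < u then entry s i else g i)" for i
    have "eval p (join c k) [n] = Some v"
      by (rule u) (simp add: join_def k_def)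
    moreover have "finite {i. k i \<noteq> g i}"
      by (rule finite_subset[of _ "{..<u}"]) (auto simp: k_def)
    ultimately show ?thesis using e by simp
  qed
  have halts: "\<exists>s. stp s p (join c (entry s)) [n] \<noteq> None" for n
  proof -
    have "eval p (join c g) [n] = Some (e n)" by (rule e) simp
    from near_stp[OF this] obtain u where
      u: "\<And>s h. u \<le> s \<Longrightarrow> \<forall>i<u. h i = join c g i \<Longrightarrow> stp s p h [n] = Some (e n)"
      unfolding near_def by blast
    obtain s where "u < s" "\<forall>i<u. entry s i = g i" using entry_dense by blast
    then have "stp s p (join c (entry s)) [n] = Some (e n)" by (intro u) (simp_all add: join_def)
    then show ?thesis by auto
  qed
  \<comment> \<open>Search for the first \<open>s\<close> with a nonzero code, then decode the value
    found there.\<close>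
  have "eval (Comp pred_prog [Comp t [Mu (Comp is_zero_prog [t]), Proj 0]]) c [n] = Some (e n)" for n
  proof -
    let ?H = "\<lambda>s. stp s p (join c (entry s)) [n] \<noteq> None"
    define s where "s = (LEAST s. ?H s)"
    have "?H s" unfolding s_def by (rule LeastI_ex[OF halts])
    then obtain v where v: "stp s p (join c (entry s)) [n] = Some v" by blast
    have "stp z p (join c (entry z)) [n] = None" if "z < s" for z
      using not_less_Least[of z ?H] that unfolding s_def by blast
    then have "eval (Mu (Comp is_zero_prog [t])) c [n] = Some s"
      unfolding eval_Mu_eq_Some_iff using v by (simp add: t)
    then show ?thesis
      using v correct[OF v] by (simp add: t del: eval.simps(7))
  qed
  then show ?thesis by (rule medvedev_le_singletonI)
qed

section \<open>Nonempty intervals\<close>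

lemma incomparable_between_mono:
  assumes "incomparable_between \<C> \<D>" and "medvedev_le \<A> \<C>" and "medvedev_le \<D> \<B>"
  shows "incomparable_between \<A> \<B>"
proof -
  obtain \<X> \<Y> where "medvedev_le \<C> \<X>" "medvedev_le \<X> \<D>" "medvedev_le \<C> \<Y>" "medvedev_le \<Y> \<D>"
    and nle: "\<not> medvedev_le \<X> \<Y>" "\<not> medvedev_le \<Y> \<X>"
    using assms(1) unfolding incomparable_between_def by blast
  then have "medvedev_le \<A> \<X>" "medvedev_le \<X> \<B>" "medvedev_le \<A> \<Y>" "medvedev_le \<Y> \<B>"
    using assms(2,3) medvedev_le_trans by blast+
  with nle show ?thesis unfolding incomparable_between_def by blast
qed

lemma incomparable_between_above_singleton:
  assumes le: "medvedev_le \<A> \<B>" "medvedev_le \<A> {c}" "medvedev_le {c} {g}"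
    and nle: "\<not> medvedev_le {g} {c}" "\<not> medvedev_le \<B> {g}"
  shows "incomparable_between \<A> \<B>"
proof (rule ccontr)
  assume no: "\<not> incomparable_between \<A> \<B>"
  \<comment> \<open>Each point of \<open>E\<close> is equivalent to \<open>g\<close>, but by
    programs that depend on the variant; a reduction uniform on \<open>E\<close> can exploit only
    \<open>c\<close>.\<close>
  define E where "E = {join c k |k. finite {i. k i \<noteq> g i}}"
  have E_le: "medvedev_le {x} {g}" if "x \<in> E" for x
  proof -
    obtain k where k: "x = join c k" "finite {i. k i \<noteq> g i}" using \<open>x \<in> E\<close> by (auto simp: E_def)
    have "medvedev_le {k} {g}" by (rule finite_change_le[OF k(2)]) simp
    then show ?thesis using join_le[OF le(3)] k(1) by simp
  qed
  have le_E: "medvedev_le {g} {x}" if "x \<in> E" for x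
  proof -
    obtain k where k: "x = join c k" "finite {i. k i \<noteq> g i}" using \<open>x \<in> E\<close> by (auto simp: E_def)
    have "medvedev_le {g} {k}" by (rule finite_change_le[OF k(2)]) simp
    then show ?thesis using le_join2 k(1) medvedev_le_trans by blast
  qed
  have nle_E: "\<not> medvedev_le \<B> {x}" if "x \<in> E" for x
    using E_le[OF that] nle(2) medvedev_le_trans by blast
  define D where "D = meet E \<B>"
  have D_E: "medvedev_le D E" unfolding D_def by (rule meet_le1)
  have "medvedev_le {c} E"
    unfolding medvedev_le_iff
    by (rule exI[of _ "Comp head_prog [Oracle]"]) (auto simp: E_def join_def)
  then have "medvedev_le \<A> E" using le(2) medvedev_le_trans by blast
  then have A_D: "medvedev_le \<A> D" unfolding D_def using le(1) by (rule le_meetI)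
  have D_B: "medvedev_le D \<B>" unfolding D_def by (rule meet_le2)
  have gE: "join c g \<in> E" by (auto simp: E_def)
  have B_D: "\<not> medvedev_le \<B> D"
  proof
    assume "medvedev_le \<B> D"
    then have "medvedev_le \<B> E" using D_E by (rule medvedev_le_trans)
    moreover have "medvedev_le E {join c g}" using gE by (intro medvedev_le_subset) simp
    ultimately have "medvedev_le \<B> {join c g}" by (rule medvedev_le_trans)
    then show False using nle_E[OF gE] by blast
  qed
  have "\<not> incomparable_between D \<B>"
    using no incomparable_between_mono[OF _ A_D medvedev_le_refl] by blast
  then obtain d where d: "d \<in> D" "medvedev_le (meet {d} \<B>) D"
    using incomparable_between_or_singleton[OF D_B B_D] by blast
  \<comment> \<open>Hence \<open>d\<close> comes from the \<open>E\<close> side of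
    \<open>D\<close>.\<close>
  have "\<not> medvedev_le \<B> {d}"
  proof
    assume "medvedev_le \<B> {d}"
    then have "medvedev_le \<B> (meet {d} \<B>)" by (rule le_meetI[OF _ medvedev_le_refl])
    then show False using d(2) B_D medvedev_le_trans by blast
  qed
  moreover have "medvedev_le \<B> {cons_fn 1 b}" if "b \<in> \<B>" for b
    by (rule medvedev_le_shift) (simp add: comp_def that)
  ultimately obtain x where x: "x \<in> E" "d = cons_fn 0 x"
    using d(1) by (auto simp: D_def meet_def)
  have "medvedev_le (meet {d} \<B>) E" using d(2) D_E by (rule medvedev_le_trans)
  then obtain p where p: "\<And>y. y \<in> E \<Longrightarrow> \<exists>h\<in>meet {d} \<B>. \<forall>n. eval p y [n] = Some (h n)"
    unfolding medvedev_le_iff by blast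
  \<comment> \<open>No point of \<open>E\<close> computes an element of \<B>, so the output always
    carries tag 0 and is the same for every \<open>y\<close>. The tag is added to the one already in
    \<open>d\<close>.\<close>
  have "eval p y [n] = Some (cons_fn 0 d n)" if "y \<in> E" for y n
  proof -
    obtain h where h: "h \<in> meet {d} \<B>" "\<And>n. eval p y [n] = Some (h n)" using p[OF \<open>y \<in> E\<close>] by blast
    have "h \<notin> cons_fn 1 ` \<B>"
    proof
      assume "h \<in> cons_fn 1 ` \<B>"
      then have "medvedev_le \<B> {h}" by (intro medvedev_le_shift) (auto simp: comp_def)
      then show False
        using nle_E[OF \<open>y \<in> E\<close>] medvedev_le_singletonI[OF h(2)] medvedev_le_trans by blast
    qed
    then have "h = cons_fn 0 d" using h(1) by (auto simp: meet_def)
    then show ?thesis using h(2) by simp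
  qed
  then have "medvedev_le {cons_fn 0 d} {c}"
    by (intro le_if_uniform[where g = g and p = p]) (auto simp: E_def)
  \<comment> \<open>Stripping both tags, \<open>c\<close> computes \<open>x\<close> and hence
    \<open>g\<close>, which is excluded.\<close>
  moreover have "medvedev_le {d} {cons_fn 0 d}" "medvedev_le {x} {d}"
    by (rule medvedev_le_shift, simp add: comp_def x(2))+
  ultimately have "medvedev_le {x} {c}" using medvedev_le_trans by blast
  then show False using le_E[OF x(1)] nle(1) medvedev_le_trans by blast
qed

lemma incomparable_between_if_strictly_between:
  assumes AX: "medvedev_le \<A> \<X>" "\<not> medvedev_le \<X> \<A>"
    and XB: "medvedev_le \<X> \<B>" "\<not> medvedev_le \<B> \<X>"
  shows "incomparable_between \<A> \<B>"
proof (rule ccontr)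
  assume no: "\<not> incomparable_between \<A> \<B>"
  have AB: "medvedev_le \<A> \<B>" using AX(1) XB(1) by (rule medvedev_le_trans)
  have BA: "\<not> medvedev_le \<B> \<A>" using AX(1) XB(2) medvedev_le_trans by blast
  obtain c where c: "c \<in> \<A>" "medvedev_le (meet {c} \<B>) \<A>"
    using incomparable_between_or_singleton[OF AB BA] no by blast
  have "\<not> incomparable_between \<X> \<B>"
    using no incomparable_between_mono[OF _ AX(1) medvedev_le_refl] by blast
  then obtain g where g: "g \<in> \<X>" "medvedev_le (meet {g} \<B>) \<X>"
    using incomparable_between_or_singleton[OF XB] by blast
  have X_g: "medvedev_le \<X> {g}" using g(1) by (intro medvedev_le_subset) simp
  have B_g: "\<not> medvedev_le \<B> {g}"
  proof
    assume "medvedev_le \<B> {g}"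
    then have "medvedev_le \<B> (meet {g} \<B>)" by (rule le_meetI[OF _ medvedev_le_refl])
    then show False using g(2) XB(2) medvedev_le_trans by blast
  qed
  \<comment> \<open>Since \<open>g\<close> computes no point of \<B>, the reduction can only produce
    \<open>c\<close>.\<close>
  have "medvedev_le (meet {c} \<B>) {g}"
    using c(2) AX(1) X_g medvedev_le_trans by blast
  then have c_g: "medvedev_le {c} {g}" using meet_le_singleton_cases B_g by blast
  \<comment> \<open>If \<open>c\<close> computed \<open>g\<close>, then \<X> would lie below both
    \<open>{c}\<close> and \<B>, hence below their meet and below \<A>.\<close>
  have g_c: "\<not> medvedev_le {g} {c}"
  proof
    assume "medvedev_le {g} {c}"
    then have "medvedev_le \<X> {c}" using X_g medvedev_le_trans by blast
    then have "medvedev_le \<X> (meet {c} \<B>)" using XB(1) by (rule le_meetI)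
    then show False using c(2) AX(2) medvedev_le_trans by blast
  qed
  have "medvedev_le \<A> {c}" using c(1) by (intro medvedev_le_subset) simp
  from incomparable_between_above_singleton[OF AB this c_g g_c B_g] no show False by blast
qed

theorem theorem8p4:
  fixes A B :: medvedev_degree
  assumes "{A<..<B} \<noteq> {}"
  shows "\<exists>X\<in>{A<..<B}. \<exists>Y\<in>{A<..<B}. \<not> X \<le> Y \<and> \<not> Y \<le> X"
proof -
  obtain C where C: "A < C" "C < B" using assms by auto
  obtain a b c where abs: "A = abs_medvedev_degree a" "B = abs_medvedev_degree b"
    "C = abs_medvedev_degree c"
    using Quotient3_abs_rep[OF Quotient3_medvedev_degree] by metis
  have "incomparable_between a b"
    using C by (intro incomparable_between_if_strictly_between[of a c b])
      (simp_all add: abs less_medvedev_degree_def less_eq_medvedev_degree.abs_eq)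
  then obtain x y where xy: "medvedev_le a x" "medvedev_le x b" "medvedev_le a y" "medvedev_le y b"
    "\<not> medvedev_le x y" "\<not> medvedev_le y x"
    unfolding incomparable_between_def by blast
  define X Y where "X = abs_medvedev_degree x" and "Y = abs_medvedev_degree y"
  have "A \<le> X" "X \<le> B" "A \<le> Y" "Y \<le> B" "\<not> X \<le> Y" "\<not> Y \<le> X"
    using xy by (simp_all add: abs X_def Y_def less_eq_medvedev_degree.abs_eq)
  \<comment> \<open>If \<open>X\<close> were an endpoint, it would be comparable with
    \<open>Y\<close>, and conversely.\<close>
  then have "X \<in> {A<..<B}" "Y \<in> {A<..<B}"
    by (auto simp: less_medvedev_degree_def intro: order_trans)
  with \<open>\<not> X \<le> Y\<close> \<open>\<not> Y \<le> X\<close> show ?thesis by blast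
qed

end
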